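(* Let $N$ and $\tau$ be integers with $1\le \tau<N$, let $(X(1),X(2),\ldots,X(N))$ be a centered non-degenerate Gaussian random vector, and let $$M_N(\tau)=\frac{1}{N-\tau}\sum_{j=1}^{N-\tau}\bigl(X(j+\tau)-X(j)\bigr)^2 .$$ Let $\lambda_1(\tau),\ldots,\lambda_{N-\tau}(\tau)$ be the eigenvalues (with multiplicity) of the covariance matrix $\Sigma(\tau)$ of the increment vector $(X(1+\tau)-X(1),\ldots,X(N)-X(N-\tau))$, and let $\bar{\lambda}(\tau)=2\max_{j}\lambda_j(\tau)$. Then for every $\epsilon>0$, $$P\left(\left|M_N(\tau)-\mathbb{E}(M_N(\tau))\right|>\epsilon\right)\leq 2\exp\left(-\frac{2\sum_{j=1}^{N-\tau}\lambda_j^2(\tau)}{\bar{\lambda}(\tau)^2}\,\mathcal{H}\left(\frac{\bar{\lambda}(\tau)\,\epsilon\,(N-\tau)}{2\sum_{j=1}^{N-\tau}\lambda_j^2(\tau)}\right)\right),$$ where $\mathcal{H}(u)=1+u-\sqrt{1+2u}$ for $u>0$.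
   Context: $M_N(\tau)$ is called the time averaged mean square displacement (TAMSD) at lag time $\tau$. A centered Gaussian vector is non-degenerate if its covariance matrix is positive definite; in that case $\Sigma(\tau)$, an $(N-\tau)\times(N-\tau)$ matrix, is also positive definite and all $\lambda_j(\tau)>0$. *)

theory Defs
  imports "HOL-Probability.Probability" "Jordan_Normal_Form.Char_Poly"
begin

(* Constants count as Gaussian (variance 0), so that linear combinations of jointly
   Gaussian variables are always Gaussian. *)
definition gaussian_rv :: "'a measure \<Rightarrow> ('a \<Rightarrow> real) \<Rightarrow> bool" where
  "gaussian_rv M Y \<longleftrightarrow> Y \<in> borel_measurable M \<and>
     (\<exists>\<mu>. (AE \<omega> in M. Y \<omega> = \<mu>) \<or>
          (\<exists>\<sigma>>0. distributed M lborel Y (\<lambda>x. ennreal (normal_density \<mu> \<sigma> x))))"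

(* Random vectors are families of random variables; only the indices 1, ..., n matter. *)
definition gaussian_vector :: "'a measure \<Rightarrow> nat \<Rightarrow> (nat \<Rightarrow> 'a \<Rightarrow> real) \<Rightarrow> bool" where
  "gaussian_vector M n X \<longleftrightarrow> (\<forall>a :: nat \<Rightarrow> real. gaussian_rv M (\<lambda>\<omega>. \<Sum>j=1..n. a j * X j \<omega>))"

definition centered_vector :: "'a measure \<Rightarrow> nat \<Rightarrow> (nat \<Rightarrow> 'a \<Rightarrow> real) \<Rightarrow> bool" where
  "centered_vector M n X \<longleftrightarrow> (\<forall>j\<in>{1..n}. integral\<^sup>L M (X j) = 0)"

definition covariance :: "'a measure \<Rightarrow> ('a \<Rightarrow> real) \<Rightarrow> ('a \<Rightarrow> real) \<Rightarrow> real" where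
  "covariance M U V =
     integral\<^sup>L M (\<lambda>\<omega>. (U \<omega> - integral\<^sup>L M U) * (V \<omega> - integral\<^sup>L M V))"

(* Matrix indices start at 0, those of the vector at 1. *)
definition covariance_matrix :: "'a measure \<Rightarrow> nat \<Rightarrow> (nat \<Rightarrow> 'a \<Rightarrow> real) \<Rightarrow> real mat" where
  "covariance_matrix M n X = Matrix.mat n n (\<lambda>(i, j). covariance M (X (Suc i)) (X (Suc j)))"

definition positive_definite :: "real mat \<Rightarrow> bool" where
  "positive_definite A \<longleftrightarrow> square_mat A \<and> transpose_mat A = A \<and>
     (\<forall>v \<in> carrier_vec (dim_row A).
        v \<noteq> 0\<^sub>v (dim_row A) \<longrightarrow> scalar_prod v (A *\<^sub>v v) > 0)"

definition nondegenerate_vector :: "'a measure \<Rightarrow> nat \<Rightarrow> (nat \<Rightarrow> 'a \<Rightarrow> real) \<Rightarrow> bool" where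
  "nondegenerate_vector M n X \<longleftrightarrow> positive_definite (covariance_matrix M n X)"

definition increment :: "nat \<Rightarrow> (nat \<Rightarrow> 'a \<Rightarrow> real) \<Rightarrow> nat \<Rightarrow> 'a \<Rightarrow> real" where
  "increment \<tau> X j \<omega> = X (j + \<tau>) \<omega> - X j \<omega>"

(* Time averaged mean square displacement of X(1), ..., X(N) at lag time \<tau>. *)
definition tamsd :: "nat \<Rightarrow> nat \<Rightarrow> (nat \<Rightarrow> 'a \<Rightarrow> real) \<Rightarrow> 'a \<Rightarrow> real" where
  "tamsd N \<tau> X \<omega> = 1 / real (N - \<tau>) * (\<Sum>j=1..N-\<tau>. (X (j + \<tau>) \<omega> - X j \<omega>)\<^sup>2)"

definition increment_cov :: "'a measure \<Rightarrow> nat \<Rightarrow> nat \<Rightarrow> (nat \<Rightarrow> 'a \<Rightarrow> real) \<Rightarrow> real mat" where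
  "increment_cov M N \<tau> X = covariance_matrix M (N - \<tau>) (increment \<tau> X)"

(* The values l 1, ..., l n list all eigenvalues of the n x n matrix A, each repeated
   according to its algebraic multiplicity: the characteristic polynomial splits as the
   product of the n linear factors x - l j. For real symmetric A such l always exists. *)
definition eigenvalues_with_mult :: "real mat \<Rightarrow> nat \<Rightarrow> (nat \<Rightarrow> real) \<Rightarrow> bool" where
  "eigenvalues_with_mult A n l \<longleftrightarrow>
     A \<in> carrier_mat n n \<and> char_poly A = (\<Prod>j=1..n. [:- l j, 1:])"

definition H_fun :: "real \<Rightarrow> real" where
  "H_fun u = 1 + u - sqrt (1 + 2 * u)"

end

theory Submission
  imports Defs "Jordan_Normal_Form.Schur_Decomposition"
begin

text \<open>
  Let \<open>Y\<close> be the increment vector, of dimension \<open>n = N - \<tau>\<close>. Then \<open>n * tamsd\<close> is the squared Euclidean norm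
  of the centered Gaussian vector \<open>Y\<close>. An orthogonal matrix that diagonalizes the covariance matrix of
  \<open>Y\<close> turns \<open>Y\<close> into a Gaussian vector \<open>Z\<close> with uncorrelated components of variances \<open>l 1, ..., l n\<close> and
  with the same norm (\<open>gaussian_vector_principal_components\<close>). Hence the deviation of \<open>n * tamsd\<close> from
  its mean is \<open>S = (\<Sum>i. (Z i)\<^sup>2) - (\<Sum>i. l i)\<close>.

  The exponential moments of \<open>\<Sum>i. (Z i)\<^sup>2\<close> are those of a weighted chi-square distribution:
  \<open>E (exp (s * (\<Sum>i. (Z i)\<^sup>2))) = (\<Prod>i. 1 / sqrt (1 - 2 * s * l i))\<close>, and similarly for negative exponents.
  Only the laws of the linear forms in \<open>Z\<close> are given, and these suffice: the exponential of a square
  is an average of exponentials of linear functions with auxiliary Gaussian coefficients, and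
  exchanging the order of integration leaves the coefficients, which are independent by construction
  (\<open>nn_integral_exp_gaussian_square_sum\<close>, \<open>integral_exp_neg_gaussian_square_sum\<close>).

  Elementary estimates of the logarithm then bound the moment generating functions of \<open>S\<close> and \<open>- S\<close> by
  \<open>exp (s\<^sup>2 * v / (2 * (1 - c * s)))\<close> for \<open>0 \<le> s < 1 / c\<close>, where \<open>v = 2 * (\<Sum>i. (l i)\<^sup>2)\<close> and \<open>c = lbar\<close>. Variables with such
  a bound are called sub-gamma, and optimizing Chernoff's bound in \<open>s\<close> gives each tail the bound
  \<open>exp (- (v / c\<^sup>2) * H_fun (c * t / v))\<close> (\<open>sub_gamma_tail\<close>). With \<open>t = n * \<epsilon>\<close>, adding the two tails proves
  the claim.
\<close>

no_notation inner (infix "\<bullet>" 70)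

section \<open>Orthogonal diagonalization of real symmetric matrices\<close>

text \<open>
  Complete \<open>v\<close> to a basis, run Gram-Schmidt starting from \<open>v\<close>, and normalize. The scalar \<open>c\<close> is
  the normalization of the first column.
\<close>
lemma orthogonal_matrix_extending_vector:
  fixes v :: "real vec"
  assumes v: "v \<in> carrier_vec n" and v0: "v \<noteq> 0\<^sub>v n"
  obtains W c where "W \<in> carrier_mat n n" "transpose_mat W * W = 1\<^sub>m n" "col W 0 = c \<cdot>\<^sub>v v"
proof -
  interpret cof_vec_space n "TYPE(real)" .
  have n: "n \<noteq> 0"
  proof
    assume "n = 0"
    with v have "v = 0\<^sub>v n" by (intro eq_vecI) auto
    with v0 show False by simp
  qed
  define b where "b = basis_completion v"
  define ws where "ws = gram_schmidt n b"
  from basis_completion[OF v v0, folded b_def]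
  have dist_b: "distinct b" and indep: "\<not> lin_dep (set b)" and b: "set b \<subseteq> carrier_vec n"
    and hdb: "hd b = v" and len_b: "length b = n" by auto
  from hdb len_b n obtain vs where bv: "b = v # vs" by (cases b) auto
  from gram_schmidt_result[OF b dist_b indep refl, folded ws_def]
  have ws: "set ws \<subseteq> carrier_vec n" "corthogonal ws" "length ws = n"
    by (auto simp: len_b)
  from gram_schmidt_hd[OF v, of vs, folded bv] have hdws: "hd ws = v" unfolding ws_def .
  define r where "r i = 1 / sqrt (ws ! i \<bullet> ws ! i)" for i
  define W where "W = mat_of_cols n (map (\<lambda>i. r i \<cdot>\<^sub>v (ws ! i)) [0..<n])"
  have W: "W \<in> carrier_mat n n" unfolding W_def by auto
  have wsi: "ws ! i \<in> carrier_vec n" if "i < n" for i using ws that by auto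
  have colW: "col W i = r i \<cdot>\<^sub>v (ws ! i)" if "i < n" for i
    unfolding W_def using that wsi[OF that] by (subst col_mat_of_cols) auto
  have orth: "(ws ! i \<bullet> ws ! j = 0) = (i \<noteq> j)" if "i < n" "j < n" for i j
    using corthogonalD[OF ws(2), of i j] that ws(3) by simp
  have "transpose_mat W * W = 1\<^sub>m n"
  proof (rule eq_matI)
    fix i j assume "i < dim_row (1\<^sub>m n)" "j < dim_col (1\<^sub>m n)"
    then have ij: "i < n" "j < n" by auto
    have "(transpose_mat W * W) $$ (i, j) = col W i \<bullet> col W j"
      using W ij by auto
    also have "\<dots> = r i * r j * (ws ! i \<bullet> ws ! j)"
      using ij wsi
      by (simp add: colW smult_scalar_prod_distrib[of _ n] scalar_prod_smult_distrib[of _ n])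
    also have "\<dots> = 1\<^sub>m n $$ (i, j)"
    proof (cases "i = j")
      case True
      have "ws ! i \<bullet> ws ! i \<noteq> 0" "ws ! i \<bullet> ws ! i \<ge> 0"
        using orth[OF ij(1) ij(1)] by (auto simp: scalar_prod_def intro!: sum_nonneg)
      then show ?thesis using True ij unfolding r_def by (simp add: divide_simps)
    next
      case False
      then show ?thesis using orth[OF ij] ij by simp
    qed
    finally show "(transpose_mat W * W) $$ (i, j) = 1\<^sub>m n $$ (i, j)" .
  qed (use W in auto)
  moreover have "col W 0 = r 0 \<cdot>\<^sub>v v"
    using colW[of 0] n hdws ws(3) by (metis gr0I hd_conv_nth length_0_conv)
  ultimately show thesis using that W by blast
qed

text \<open>
  Induction on the list of roots, deflating one eigenvalue at a time. A unit eigenvector of \<open>e\<close>,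
  completed to an orthogonal matrix \<open>W\<close>, turns the first column of \<open>W\<^sup>TAW\<close> into \<open>e\<close> followed by
  zeros; symmetry does the same to the first row. What remains is a smaller symmetric block whose
  characteristic polynomial has the remaining roots, so the order of \<open>es\<close> is kept on the diagonal.
  That the characteristic polynomial splits is an assumption here, which spares the proof that a
  real symmetric matrix has a real eigenvalue.
\<close>
theorem real_spectral_theorem:
  fixes A :: "real mat"
  assumes "A \<in> carrier_mat n n" and "transpose_mat A = A"
    and "char_poly A = (\<Prod>e\<leftarrow>es. [:- e, 1:])"
  shows "\<exists>U\<in>carrier_mat n n. transpose_mat U * U = 1\<^sub>m n \<and>
    transpose_mat U * A * U = mat n n (\<lambda>(i, j). if i = j then es ! i else 0)"
  using assms
proof (induction es arbitrary: n A)
  case Nil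
  then have "n = 0" using degree_monic_char_poly[of A n] by auto
  then show ?case by (intro bexI[of _ "1\<^sub>m n"]) (auto intro!: eq_matI)
next
  case (Cons e es n A)
  note A = Cons.prems(1) and symA = Cons.prems(2)
  have cp: "char_poly A = [:- e, 1:] * (\<Prod>e\<leftarrow>es. [:- e, 1:])" using Cons.prems(3) by simp
  have mon: "monic (\<Prod>e\<leftarrow>es. [:- e, 1:])" by (rule monic_prod_list) auto
  have "degree (char_poly A) = Suc (degree (\<Prod>e\<leftarrow>es. [:- e, 1:]))" unfolding cp
    by (subst degree_mult_eq) (use mon in auto)
  then obtain m where n: "n = Suc m" using degree_monic_char_poly[OF A] by (cases n) auto
  have "eigenvalue A e" unfolding eigenvalue_root_char_poly[OF A] cp by simp
  then obtain v where "eigenvector A v e" unfolding eigenvalue_def by auto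
  then have v: "v \<in> carrier_vec n" "v \<noteq> 0\<^sub>v n" and Av: "A *\<^sub>v v = e \<cdot>\<^sub>v v"
    using A unfolding eigenvector_def by auto
  obtain W c where W: "W \<in> carrier_mat n n" and WW: "transpose_mat W * W = 1\<^sub>m n"
    and W0: "col W 0 = c \<cdot>\<^sub>v v"
    by (rule orthogonal_matrix_extending_vector[OF v])
  have Wt: "transpose_mat W \<in> carrier_mat n n" using W by simp
  have WW': "W * transpose_mat W = 1\<^sub>m n" by (rule mat_mult_left_right_inverse[OF Wt W WW])
  define A' where "A' = transpose_mat W * A * W"
  have A': "A' \<in> carrier_mat n n" unfolding A'_def using A W by auto
  have symA': "transpose_mat A' = A'"
  proof -
    have "transpose_mat A' = transpose_mat W * transpose_mat (transpose_mat W * A)"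
      unfolding A'_def using A W by (intro transpose_mult[of _ n n _ n]) auto
    also have "transpose_mat (transpose_mat W * A) = transpose_mat A * W"
      using A W by (subst transpose_mult[of _ n n _ n]) auto
    finally show ?thesis unfolding A'_def symA
      using A W by (simp add: assoc_mult_mat[of _ n n _ n _ n])
  qed
  have "similar_mat_wit A' A (transpose_mat W) W"
    by (rule similar_mat_witI[of _ _ n]) (use W Wt A A' WW WW' in \<open>auto simp: A'_def\<close>)
  then have cpA': "char_poly A' = char_poly A"
    by (intro char_poly_similar) (auto simp: similar_mat_def)
  have AW0: "A *\<^sub>v col W 0 = e \<cdot>\<^sub>v col W 0"
    unfolding W0 using A v Av by (simp add: mult_mat_vec smult_smult_assoc mult.commute)
  \<comment> \<open>The remaining columns of \<open>W\<close> are orthogonal to the eigenvector \<open>col W 0\<close>.\<close>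
  have col0: "A' $$ (i, 0) = (if i = 0 then e else 0)" if i: "i < n" for i
  proof -
    have "A' = transpose_mat W * (A * W)" unfolding A'_def using A W
      by (simp add: assoc_mult_mat[of _ n n _ n _ n])
    then have "A' $$ (i, 0) = col W i \<bullet> col (A * W) 0"
      using A W i n by auto
    also have "col (A * W) 0 = e \<cdot>\<^sub>v col W 0"
      using A W n AW0 by (subst col_mult2[of _ n n _ n]) auto
    also have "col W i \<bullet> (e \<cdot>\<^sub>v col W 0) = e * (col W i \<bullet> col W 0)"
      using W by (intro scalar_prod_smult_distrib[of _ n] carrier_vecI) auto
    also have "col W i \<bullet> col W 0 = (transpose_mat W * W) $$ (i, 0)"
      using W i n by auto
    finally show ?thesis using i n unfolding WW by auto
  qed
  have row0: "A' $$ (0, i) = (if i = 0 then e else 0)" if i: "i < n" for i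
  proof -
    have "A' $$ (0, i) = transpose_mat A' $$ (0, i)" unfolding symA' ..
    also have "\<dots> = A' $$ (i, 0)" using A' i n by auto
    finally show ?thesis using col0[OF i] by simp
  qed
  define A3 where "A3 = mat m m (\<lambda>(i, j). A' $$ (Suc i, Suc j))"
  define E where "E = mat 1 1 (\<lambda>_. e)"
  have A3: "A3 \<in> carrier_mat m m" and E: "E \<in> carrier_mat 1 1" unfolding A3_def E_def by auto
  have block: "A' = four_block_mat E (0\<^sub>m 1 m) (0\<^sub>m m 1) A3"
    using A' n by (intro eq_matI) (auto simp: E_def A3_def col0 row0)
  have symA3: "transpose_mat A3 = A3"
  proof (rule eq_matI)
    fix i j assume ij: "i < dim_row A3" "j < dim_col A3"
    have "A' $$ (Suc j, Suc i) = transpose_mat A' $$ (Suc i, Suc j)"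
      using ij A' n A3 by auto
    then show "transpose_mat A3 $$ (i, j) = A3 $$ (i, j)"
      using ij unfolding symA' by (simp add: A3_def)
  qed (use A3 in auto)
  have "char_poly A' = char_poly E * char_poly A3"
    unfolding block by (rule char_poly_four_block_zeros_col[OF E _ A3]) simp
  moreover have "char_poly E = [:- e, 1:]"
    by (simp add: E_def char_poly_defs det_def sign_def)
  ultimately have "char_poly A3 = (\<Prod>e\<leftarrow>es. [:- e, 1:])"
    using cpA' cp by (metis mult_cancel_left pCons_eq_0_iff zero_neq_one)
  from Cons.IH[OF A3 symA3 this] obtain V where V: "V \<in> carrier_mat m m"
    and VV: "transpose_mat V * V = 1\<^sub>m m"
    and VAV: "transpose_mat V * A3 * V = mat m m (\<lambda>(i, j). if i = j then es ! i else 0)"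
    by blast
  define V' where "V' = four_block_mat (1\<^sub>m 1) (0\<^sub>m 1 m) (0\<^sub>m m 1) V"
  have V': "V' \<in> carrier_mat n n" unfolding V'_def n using V by auto
  have V't: "transpose_mat V' = four_block_mat (1\<^sub>m 1) (0\<^sub>m 1 m) (0\<^sub>m m 1) (transpose_mat V)"
    unfolding V'_def using V by (subst transpose_four_block_mat[of _ 1 1 _ m _ m]) auto
  have V'V': "transpose_mat V' * V' = 1\<^sub>m n"
    unfolding V't unfolding V'_def
    using V by (subst mult_four_block_mat[of _ 1 1 _ m _ m _ _ 1 _ m]) (auto simp: VV n)
  have V'A'V': "transpose_mat V' * A' * V' =
      four_block_mat E (0\<^sub>m 1 m) (0\<^sub>m m 1) (transpose_mat V * A3 * V)"
    unfolding V't block unfolding V'_def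
    using V A3 E
    by (subst mult_four_block_mat[of _ 1 1 _ m _ m _ _ 1 _ m], simp_all)
       (subst mult_four_block_mat[of _ 1 1 _ m _ m _ _ 1 _ m], simp_all)
  define U where "U = W * V'"
  have U: "U \<in> carrier_mat n n" unfolding U_def using W V' by auto
  have Ut: "transpose_mat U = transpose_mat V' * transpose_mat W"
    unfolding U_def using W V' by (rule transpose_mult)
  have V't': "transpose_mat V' \<in> carrier_mat n n" using V' by simp
  have "transpose_mat U * U = transpose_mat V' * (transpose_mat W * W) * V'"
    unfolding Ut unfolding U_def using W Wt V' V't'
    by (simp add: assoc_mult_mat[of _ n n _ n _ n])
  then have UU: "transpose_mat U * U = 1\<^sub>m n" using V'V' V't' WW by simp
  have "transpose_mat U * A * U = transpose_mat V' * A' * V'"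
    unfolding Ut unfolding U_def A'_def using W Wt V' V't' A
    by (simp add: assoc_mult_mat[of _ n n _ n _ n])
  also have "\<dots> = mat n n (\<lambda>(i, j). if i = j then (e # es) ! i else 0)"
    unfolding V'A'V' VAV using n
    by (intro eq_matI) (auto simp: E_def less_Suc_eq_0_disj split: if_splits)
  finally show ?case using U UU by blast
qed

text \<open>
  The spectral theorem in coordinates counted from \<open>1\<close>: \<open>u i\<close> is the \<open>i\<close>-th unit eigenvector. The first
  conjunct says that the matrix \<open>u\<close> has orthonormal columns, which is what makes
  \<open>x \<mapsto> (\<Sum>a. u i a * x a)\<^sub>i\<close> preserve Euclidean norms.
\<close>
lemma symmetric_diagonalization_coefficients:
  assumes C: "C \<in> carrier_mat n n" and sym: "transpose_mat C = C"
    and l: "eigenvalues_with_mult C n l"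
  shows "\<exists>u :: nat \<Rightarrow> nat \<Rightarrow> real.
    (\<forall>a\<in>{1..n}. \<forall>b\<in>{1..n}. (\<Sum>i=1..n. u i a * u i b) = (if a = b then 1 else 0)) \<and>
    (\<forall>i\<in>{1..n}. \<forall>j\<in>{1..n}. (\<Sum>a=1..n. \<Sum>b=1..n. u i a * u j b * C $$ (a - 1, b - 1)) =
      (if i = j then l i else 0))"
proof -
  have "char_poly C = (\<Prod>e\<leftarrow>map l [1..<Suc n]. [:- e, 1:])"
    using l unfolding eigenvalues_with_mult_def
    by (simp add: prod.distinct_set_conv_list[symmetric] o_def atLeastLessThanSuc_atLeastAtMost del: upt_Suc)
  from real_spectral_theorem[OF C sym this] obtain U where U: "U \<in> carrier_mat n n"
    and UU: "transpose_mat U * U = 1\<^sub>m n"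
    and UCU: "transpose_mat U * C * U =
      mat n n (\<lambda>(i, j). if i = j then map l [1..<Suc n] ! i else 0)" by blast
  have UU': "U * transpose_mat U = 1\<^sub>m n"
    by (rule mat_mult_left_right_inverse[OF _ U UU]) (use U in simp)
  have shift: "(\<Sum>a=1..n. f (a - 1)) = (\<Sum>a<n. f a)" for f :: "nat \<Rightarrow> real"
    by (rule sum.reindex_bij_witness[of _ Suc "\<lambda>a. a - 1"]) auto
  define u where "u i a = U $$ (a - 1, i - 1)" for i a
  show ?thesis
  proof (intro exI[of _ u] conjI ballI)
    fix a b assume ab: "a \<in> {1..n}" "b \<in> {1..n}"
    have "(\<Sum>i=1..n. u i a * u i b) = (U * transpose_mat U) $$ (a - 1, b - 1)"
      unfolding u_def using U ab
      by (subst shift[of "\<lambda>i. U $$ (a - 1, i) * U $$ (b - 1, i)"])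
         (auto simp: scalar_prod_def atLeast0LessThan intro!: sum.cong)
    then show "(\<Sum>i=1..n. u i a * u i b) = (if a = b then 1 else 0)"
      unfolding UU' using ab by auto
  next
    fix i j assume ij: "i \<in> {1..n}" "j \<in> {1..n}"
    have "(\<Sum>a=1..n. \<Sum>b=1..n. u i a * u j b * C $$ (a - 1, b - 1)) =
      (\<Sum>a<n. \<Sum>b<n. U $$ (a, i - 1) * U $$ (b, j - 1) * C $$ (a, b))"
      unfolding u_def
      by (subst shift[of "\<lambda>a. \<Sum>b=1..n. U $$ (a, i - 1) * U $$ (b - 1, j - 1) * C $$ (a, b - 1)"])
         (intro sum.cong refl shift[of "\<lambda>b. U $$ (_, i - 1) * U $$ (b, j - 1) * C $$ (_, b)"])
    also have "\<dots> = (transpose_mat U * C * U) $$ (i - 1, j - 1)"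
      using U C ij
      by (auto simp: scalar_prod_def atLeast0LessThan sum_distrib_right sum_distrib_left mult_ac intro!: sum.cong)
    also have "\<dots> = (if i = j then l i else 0)"
      unfolding UCU using ij by (auto simp del: upt_Suc)
    finally show "(\<Sum>a=1..n. \<Sum>b=1..n. u i a * u j b * C $$ (a - 1, b - 1)) =
      (if i = j then l i else 0)" .
  qed
qed

section \<open>Centered Gaussian variables\<close>

lemma prob_space_std_normal: "prob_space std_normal_distribution"
  using prob_space_normal_density[of 1 0] by simp

text \<open>
  Completing the square turns the integrand into a multiple of the density with mean \<open>t\<close>.
\<close>
lemma nn_integral_std_normal_exp_linear:
  "(\<integral>\<^sup>+x. ennreal (exp (t * x)) \<partial>std_normal_distribution) = ennreal (exp (t\<^sup>2 / 2))"
proof -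
  have eq: "std_normal_density x * exp (t * x) = exp (t\<^sup>2 / 2) * normal_density t 1 x" for x
    by (simp add: normal_density_def exp_add[symmetric] power2_eq_square field_simps)
  have "(\<integral>\<^sup>+x. ennreal (exp (t * x)) \<partial>std_normal_distribution) =
      (\<integral>\<^sup>+x. ennreal (exp (t\<^sup>2 / 2)) * ennreal (normal_density t 1 x) \<partial>lborel)"
    by (subst nn_integral_density)
       (auto simp: ennreal_mult'[symmetric] eq intro!: nn_integral_cong)
  also have "\<dots> = ennreal (exp (t\<^sup>2 / 2)) * (\<integral>\<^sup>+x. ennreal (normal_density t 1 x) \<partial>lborel)"
    by (rule nn_integral_cmult) simp
  also have "(\<integral>\<^sup>+x. ennreal (normal_density t 1 x) \<partial>lborel) = 1"
    by (subst nn_integral_eq_integral) auto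
  finally show ?thesis by simp
qed

text \<open>
  The integrand is a multiple of the centered normal density with variance \<open>1 / (1 - 2 * a)\<close>.
\<close>
lemma nn_integral_std_normal_exp_square:
  assumes a: "2 * a < 1"
  shows "(\<integral>\<^sup>+x. ennreal (exp (a * x\<^sup>2)) \<partial>std_normal_distribution) = ennreal (1 / sqrt (1 - 2 * a))"
proof -
  define r where "r = 1 / sqrt (1 - 2 * a)"
  have r: "r > 0" and r2: "r\<^sup>2 = 1 / (1 - 2 * a)" using a by (auto simp: r_def power_divide)
  have eq: "std_normal_density x * exp (a * x\<^sup>2) = r * normal_density 0 r x" for x
  proof -
    have "- x\<^sup>2 / 2 + a * x\<^sup>2 = - x\<^sup>2 / (2 * r\<^sup>2)" using a by (simp add: r2 field_simps)
    then have "std_normal_density x * exp (a * x\<^sup>2) = 1 / sqrt (2 * pi) * exp (- x\<^sup>2 / (2 * r\<^sup>2))"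
      unfolding std_normal_density_def by (simp add: exp_add[symmetric])
    also have "1 / sqrt (2 * pi) = r * (1 / sqrt (2 * pi * r\<^sup>2))"
      using r by (simp add: real_sqrt_mult)
    finally show ?thesis by (simp add: normal_density_def)
  qed
  have "(\<integral>\<^sup>+x. ennreal (exp (a * x\<^sup>2)) \<partial>std_normal_distribution) =
      (\<integral>\<^sup>+x. ennreal r * ennreal (normal_density 0 r x) \<partial>lborel)"
    using r
    by (subst nn_integral_density)
       (auto simp: ennreal_mult'[symmetric] eq intro!: nn_integral_cong)
  also have "\<dots> = ennreal r * (\<integral>\<^sup>+x. ennreal (normal_density 0 r x) \<partial>lborel)"
    by (rule nn_integral_cmult) simp
  also have "(\<integral>\<^sup>+x. ennreal (normal_density 0 r x) \<partial>lborel) = 1"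
    using r by (subst nn_integral_eq_integral) auto
  finally show ?thesis unfolding r_def by simp
qed

lemma integral_std_normal_exp_neg_square:
  assumes a: "0 \<le> a"
  shows "integrable std_normal_distribution (\<lambda>x. exp (- (a * x\<^sup>2)))"
    and "(\<integral>x. exp (- (a * x\<^sup>2)) \<partial>std_normal_distribution) = 1 / sqrt (1 + 2 * a)"
proof -
  have nn: "(\<integral>\<^sup>+x. ennreal (exp (- (a * x\<^sup>2))) \<partial>std_normal_distribution) = ennreal (1 / sqrt (1 + 2 * a))"
    using nn_integral_std_normal_exp_square[of "- a"] a by simp
  then show "integrable std_normal_distribution (\<lambda>x. exp (- (a * x\<^sup>2)))"
    by (intro integrableI_nonneg) auto
  show "(\<integral>x. exp (- (a * x\<^sup>2)) \<partial>std_normal_distribution) = 1 / sqrt (1 + 2 * a)"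
    by (rule integral_eq_nn_integral[THEN trans]) (use nn a in auto)
qed

text \<open>
  Writing the law as that of \<open>\<sigma> * g\<close> with \<open>g\<close> standard normal treats the constant case (\<open>\<sigma> = 0\<close>) and
  the case of a density together.
\<close>
lemma centered_gaussian_law:
  assumes "prob_space M" and Y: "gaussian_rv M Y" and mean: "integral\<^sup>L M Y = 0"
  obtains \<sigma> where "\<sigma> \<ge> 0" "distr M borel Y = distr std_normal_distribution borel (\<lambda>x. \<sigma> * x)"
proof -
  interpret prob_space M by fact
  interpret G: prob_space std_normal_distribution by (rule prob_space_std_normal)
  have [measurable]: "Y \<in> borel_measurable M" using Y by (simp add: gaussian_rv_def)
  from Y obtain \<mu> where "(AE \<omega> in M. Y \<omega> = \<mu>) \<or>
      (\<exists>\<sigma>>0. distributed M lborel Y (\<lambda>x. ennreal (normal_density \<mu> \<sigma> x)))"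
    unfolding gaussian_rv_def by blast
  then show thesis
  proof
    assume AE: "AE \<omega> in M. Y \<omega> = \<mu>"
    have "integral\<^sup>L M Y = integral\<^sup>L M (\<lambda>_. \<mu>)" by (rule integral_cong_AE) (use AE in auto)
    then have "\<mu> = 0" using mean by (simp add: prob_space)
    then have "distr M borel Y = distr M borel (\<lambda>_. 0)" using AE by (intro distr_cong_AE) auto
    also have "\<dots> = distr std_normal_distribution borel (\<lambda>x. 0 * x)" by (simp add: G.distr_const)
    finally show thesis by (rule that[rotated]) simp
  next
    assume "\<exists>\<sigma>>0. distributed M lborel Y (\<lambda>x. ennreal (normal_density \<mu> \<sigma> x))"
    then obtain \<sigma> where \<sigma>: "\<sigma> > 0"
      and D: "distributed M lborel Y (\<lambda>x. ennreal (normal_density \<mu> \<sigma> x))" by blast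
    have "\<mu> = 0" using normal_distributed_expectation[OF \<sigma> D] mean by simp
    with D have "distributed M lborel (\<lambda>\<omega>. Y \<omega> / \<sigma>) (\<lambda>x. ennreal (std_normal_density x))"
      using normal_standard_normal_convert[OF \<sigma>, of Y 0] by simp
    then have "distr M lborel (\<lambda>\<omega>. Y \<omega> / \<sigma>) = std_normal_distribution"
      by (rule distributed_distr_eq_density)
    moreover have "distr (distr M lborel (\<lambda>\<omega>. Y \<omega> / \<sigma>)) borel (\<lambda>x. \<sigma> * x) =
        distr M borel ((\<lambda>x. \<sigma> * x) \<circ> (\<lambda>\<omega>. Y \<omega> / \<sigma>))"
      by (rule distr_distr) auto
    moreover have "(\<lambda>x. \<sigma> * x) \<circ> (\<lambda>\<omega>. Y \<omega> / \<sigma>) = Y" using \<sigma> by (auto simp: fun_eq_iff)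
    ultimately show thesis using \<sigma> by (intro that[of \<sigma>]) auto
  qed
qed

text \<open>
  A centered Gaussian variable enters the argument only through these facts, in which its law appears
  as its second moment alone.
\<close>
lemma centered_gaussian_moments:
  assumes M: "prob_space M" and Y: "gaussian_rv M Y" and mean: "integral\<^sup>L M Y = 0"
  shows "integrable M (\<lambda>\<omega>. (Y \<omega>)\<^sup>2)"
    and "(\<integral>\<^sup>+\<omega>. ennreal (exp (Y \<omega>)) \<partial>M) = ennreal (exp ((\<integral>\<omega>. (Y \<omega>)\<^sup>2 \<partial>M) / 2))"
    and "(\<integral>\<omega>. iexp (Y \<omega>) \<partial>M) = complex_of_real (exp (- (\<integral>\<omega>. (Y \<omega>)\<^sup>2 \<partial>M) / 2))"
proof -
  have [measurable]: "Y \<in> borel_measurable M" using Y by (simp add: gaussian_rv_def)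
  obtain \<sigma> where \<sigma>: "\<sigma> \<ge> 0" and law: "distr M borel Y = distr std_normal_distribution borel (\<lambda>x. \<sigma> * x)"
    using centered_gaussian_law[OF M Y mean] .
  have "integrable (distr std_normal_distribution borel (\<lambda>x. \<sigma> * x)) (\<lambda>y. y\<^sup>2)"
    using integrable_std_normal_distribution_moment[of 2]
    by (subst integrable_distr_eq) (auto simp: power_mult_distrib)
  then show "integrable M (\<lambda>\<omega>. (Y \<omega>)\<^sup>2)"
    unfolding law[symmetric] by (subst (asm) integrable_distr_eq) auto
  have "(\<integral>\<omega>. (Y \<omega>)\<^sup>2 \<partial>M) = (\<integral>y. y\<^sup>2 \<partial>distr M borel Y)" by (subst integral_distr) auto
  also have "\<dots> = \<sigma>\<^sup>2 * (\<integral>x. x\<^sup>2 \<partial>std_normal_distribution)"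
    unfolding law by (subst integral_distr) (auto simp: power_mult_distrib)
  also have "(\<integral>x. x\<^sup>2 \<partial>std_normal_distribution) = 1"
    using std_normal_distribution_even_moments(1)[of 1] by (simp add: fact_numeral)
  finally have var: "(\<integral>\<omega>. (Y \<omega>)\<^sup>2 \<partial>M) = \<sigma>\<^sup>2" by simp
  have "(\<integral>\<^sup>+\<omega>. ennreal (exp (Y \<omega>)) \<partial>M) = (\<integral>\<^sup>+y. ennreal (exp y) \<partial>distr M borel Y)"
    by (subst nn_integral_distr) auto
  also have "\<dots> = (\<integral>\<^sup>+x. ennreal (exp (\<sigma> * x)) \<partial>std_normal_distribution)"
    unfolding law by (subst nn_integral_distr) auto
  finally show "(\<integral>\<^sup>+\<omega>. ennreal (exp (Y \<omega>)) \<partial>M) = ennreal (exp ((\<integral>\<omega>. (Y \<omega>)\<^sup>2 \<partial>M) / 2))"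
    unfolding var nn_integral_std_normal_exp_linear .
  have "(\<integral>\<omega>. iexp (Y \<omega>) \<partial>M) = (\<integral>y. iexp y \<partial>distr M borel Y)"
    by (subst integral_distr) auto
  also have "\<dots> = char std_normal_distribution \<sigma>"
    unfolding law char_def by (subst integral_distr) auto
  finally show "(\<integral>\<omega>. iexp (Y \<omega>) \<partial>M) = complex_of_real (exp (- (\<integral>\<omega>. (Y \<omega>)\<^sup>2 \<partial>M) / 2))"
    unfolding var char_std_normal_distribution .
qed

section \<open>Exponential moments of sums of squares\<close>

lemma gaussian_vector_component:
  assumes Z: "gaussian_vector M n Z" and i: "i \<in> {1..n}"
  shows "gaussian_rv M (Z i)"
proof -
  have "(\<Sum>j=1..n. (if j = i then 1 else 0) * Z j \<omega>) = Z i \<omega>" for \<omega>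
  proof -
    have "(\<Sum>j=1..n. (if j = i then 1 else 0) * Z j \<omega>) = (\<Sum>j=1..n. if j = i then Z j \<omega> else 0)"
      by (rule sum.cong) auto
    then show ?thesis using i by simp
  qed
  with Z[unfolded gaussian_vector_def, THEN spec, of "\<lambda>j. if j = i then 1 else 0"]
  show ?thesis by (simp only:)
qed

lemma gaussian_vector_measurable:
  "gaussian_vector M n Z \<Longrightarrow> i \<in> {1..n} \<Longrightarrow> Z i \<in> borel_measurable M"
  using gaussian_vector_component[of M n Z i] unfolding gaussian_rv_def by blast

text \<open>
  The joint measurability that the exchange of integrals below requires.
\<close>
lemma borel_measurable_pair_linear_form:
  fixes Z :: "'i \<Rightarrow> 'a \<Rightarrow> real"
  assumes "\<And>i. i \<in> I \<Longrightarrow> Z i \<in> borel_measurable M"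
    and "sets N = sets borel"
  shows "(\<lambda>p. \<Sum>i\<in>I. r * snd p i * Z i (fst p)) \<in> borel_measurable (M \<Otimes>\<^sub>M (\<Pi>\<^sub>M i\<in>I. N))"
proof (intro borel_measurable_sum borel_measurable_times borel_measurable_const)
  fix i assume i: "i \<in> I"
  show "(\<lambda>p. Z i (fst p)) \<in> borel_measurable (M \<Otimes>\<^sub>M (\<Pi>\<^sub>M i\<in>I. N))"
    using measurable_compose[OF measurable_fst assms(1)[OF i]] .
  have "(\<lambda>p. snd p i) \<in> measurable (M \<Otimes>\<^sub>M (\<Pi>\<^sub>M i\<in>I. N)) N"
    using measurable_compose[OF measurable_snd measurable_component_singleton[OF i]] .
  then show "(\<lambda>p. snd p i) \<in> borel_measurable (M \<Otimes>\<^sub>M (\<Pi>\<^sub>M i\<in>I. N))"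
    by (subst measurable_cong_sets[OF refl assms(2)[symmetric]])
qed

text \<open>
  The exponential of a square is a Gaussian average of exponentials of linear functions,
  \<open>exp (s * z\<^sup>2) = E (exp (sqrt (2 * s) * g * z))\<close> with \<open>g\<close> standard normal. With one independent \<open>g i\<close>
  for each \<open>Z i\<close>, Tonelli's theorem allows averaging over \<open>Z\<close> first. There only the linear form
  \<open>\<Sum>i. g i * Z i\<close> occurs, whose law is known from its variance, and the result factorizes over \<open>i\<close>
  because the \<open>g i\<close> are independent by construction. So uncorrelated \<open>Z i\<close> never have to be shown
  independent.
\<close>
lemma nn_integral_exp_gaussian_square_sum:
  assumes M: "prob_space M" and Z: "gaussian_vector M n Z"
    and mean: "\<And>a. (\<integral>\<omega>. (\<Sum>i=1..n. a i * Z i \<omega>) \<partial>M) = 0"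
    and var: "\<And>a. (\<integral>\<omega>. (\<Sum>i=1..n. a i * Z i \<omega>)\<^sup>2 \<partial>M) = (\<Sum>i=1..n. l i * (a i)\<^sup>2)"
    and s: "0 \<le> s" "\<And>i. i \<in> {1..n} \<Longrightarrow> 2 * (s * l i) < 1"
  shows "(\<integral>\<^sup>+\<omega>. ennreal (exp (s * (\<Sum>i=1..n. (Z i \<omega>)\<^sup>2))) \<partial>M) =
    ennreal (\<Prod>i=1..n. 1 / sqrt (1 - 2 * (s * l i)))"
proof -
  interpret M: prob_space M by fact
  interpret g: prob_space std_normal_distribution by (rule prob_space_std_normal)
  interpret P: product_sigma_finite "\<lambda>_::nat. std_normal_distribution" by unfold_locales
  let ?G = "\<Pi>\<^sub>M i\<in>{1..n}. std_normal_distribution"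
  interpret G: prob_space ?G by (rule prob_space_PiM) (rule prob_space_std_normal)
  interpret MG: pair_sigma_finite M ?G by unfold_locales
  define r where "r = sqrt (2 * s)"
  have r2: "r\<^sup>2 = 2 * s" using s by (simp add: r_def)
  have meas: "(\<lambda>p. \<Sum>i=1..n. r * snd p i * Z i (fst p)) \<in> borel_measurable (M \<Otimes>\<^sub>M ?G)"
    by (rule borel_measurable_pair_linear_form[OF gaussian_vector_measurable[OF Z]]) auto
  have "(\<integral>\<^sup>+\<omega>. ennreal (exp (s * (\<Sum>i=1..n. (Z i \<omega>)\<^sup>2))) \<partial>M) =
    (\<integral>\<^sup>+\<omega>. (\<integral>\<^sup>+g. ennreal (exp (\<Sum>i=1..n. r * g i * Z i \<omega>)) \<partial>?G) \<partial>M)"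
  proof (rule nn_integral_cong)
    fix \<omega>
    have "ennreal (exp (s * (\<Sum>i=1..n. (Z i \<omega>)\<^sup>2))) = (\<Prod>i=1..n. ennreal (exp ((r * Z i \<omega>)\<^sup>2 / 2)))"
      by (simp add: prod_ennreal exp_sum sum_distrib_left power_mult_distrib r2)
    also have "\<dots> = (\<Prod>i=1..n. \<integral>\<^sup>+x. ennreal (exp (r * Z i \<omega> * x)) \<partial>std_normal_distribution)"
      by (simp add: nn_integral_std_normal_exp_linear)
    also have "\<dots> = (\<integral>\<^sup>+g. (\<Prod>i=1..n. ennreal (exp (r * Z i \<omega> * g i))) \<partial>?G)"
      by (rule P.product_nn_integral_prod[symmetric]) auto
    also have "\<dots> = (\<integral>\<^sup>+g. ennreal (exp (\<Sum>i=1..n. r * g i * Z i \<omega>)) \<partial>?G)"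
      by (simp add: prod_ennreal exp_sum mult_ac)
    finally show "ennreal (exp (s * (\<Sum>i=1..n. (Z i \<omega>)\<^sup>2))) =
      (\<integral>\<^sup>+g. ennreal (exp (\<Sum>i=1..n. r * g i * Z i \<omega>)) \<partial>?G)" .
  qed
  also have "\<dots> = (\<integral>\<^sup>+g. (\<integral>\<^sup>+\<omega>. ennreal (exp (\<Sum>i=1..n. r * g i * Z i \<omega>)) \<partial>M) \<partial>?G)"
    by (rule MG.Fubini'[symmetric]) (use meas in \<open>simp add: split_beta'\<close>)
  also have "\<dots> = (\<integral>\<^sup>+g. (\<Prod>i=1..n. ennreal (exp (s * l i * (g i)\<^sup>2))) \<partial>?G)"
  proof (rule nn_integral_cong)
    fix g :: "nat \<Rightarrow> real"
    have "(\<integral>\<^sup>+\<omega>. ennreal (exp (\<Sum>i=1..n. r * g i * Z i \<omega>)) \<partial>M) =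
      ennreal (exp ((\<Sum>i=1..n. l i * (r * g i)\<^sup>2) / 2))"
      using centered_gaussian_moments(2)[OF M Z[unfolded gaussian_vector_def, THEN spec] mean,
          of "\<lambda>i. r * g i"]
      by (simp only: var)
    also have "(\<Sum>i=1..n. l i * (r * g i)\<^sup>2) / 2 = (\<Sum>i=1..n. s * l i * (g i)\<^sup>2)"
      by (simp add: sum_divide_distrib power_mult_distrib r2 mult_ac)
    finally show "(\<integral>\<^sup>+\<omega>. ennreal (exp (\<Sum>i=1..n. r * g i * Z i \<omega>)) \<partial>M) =
      (\<Prod>i=1..n. ennreal (exp (s * l i * (g i)\<^sup>2)))"
      by (simp add: prod_ennreal exp_sum)
  qed
  also have "\<dots> = (\<Prod>i=1..n. \<integral>\<^sup>+x. ennreal (exp (s * l i * x\<^sup>2)) \<partial>std_normal_distribution)"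
    by (rule P.product_nn_integral_prod) auto
  also have "\<dots> = (\<Prod>i=1..n. ennreal (1 / sqrt (1 - 2 * (s * l i))))"
    using s by (intro prod.cong refl nn_integral_std_normal_exp_square) auto
  also have "\<dots> = ennreal (\<Prod>i=1..n. 1 / sqrt (1 - 2 * (s * l i)))"
    using s by (intro prod_ennreal) (auto simp: less_imp_le)
  finally show ?thesis .
qed

text \<open>
  The same argument with characteristic functions in place of moment generating functions:
  \<open>exp (- s * z\<^sup>2) = E (exp (\<i> * sqrt (2 * s) * g * z))\<close>. All integrands have absolute value at most
  \<open>1\<close>, so Fubini's theorem applies.
\<close>
lemma integral_exp_neg_gaussian_square_sum:
  assumes M: "prob_space M" and Z: "gaussian_vector M n Z"
    and mean: "\<And>a. (\<integral>\<omega>. (\<Sum>i=1..n. a i * Z i \<omega>) \<partial>M) = 0"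
    and var: "\<And>a. (\<integral>\<omega>. (\<Sum>i=1..n. a i * Z i \<omega>)\<^sup>2 \<partial>M) = (\<Sum>i=1..n. l i * (a i)\<^sup>2)"
    and l: "\<And>i. i \<in> {1..n} \<Longrightarrow> 0 \<le> l i" and s: "0 \<le> s"
  shows "(\<integral>\<omega>. exp (- (s * (\<Sum>i=1..n. (Z i \<omega>)\<^sup>2))) \<partial>M) =
    (\<Prod>i=1..n. 1 / sqrt (1 + 2 * (s * l i)))"
proof -
  interpret M: prob_space M by fact
  interpret g: prob_space std_normal_distribution by (rule prob_space_std_normal)
  interpret P: product_sigma_finite "\<lambda>_::nat. std_normal_distribution" by unfold_locales
  let ?G = "\<Pi>\<^sub>M i\<in>{1..n}. std_normal_distribution"
  interpret G: prob_space ?G by (rule prob_space_PiM) (rule prob_space_std_normal)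
  interpret MG: pair_prob_space M ?G by unfold_locales
  define r where "r = sqrt (2 * s)"
  have r2: "r\<^sup>2 = 2 * s" using s by (simp add: r_def)
  have meas: "(\<lambda>p. \<Sum>i=1..n. r * snd p i * Z i (fst p)) \<in> borel_measurable (M \<Otimes>\<^sub>M ?G)"
    by (rule borel_measurable_pair_linear_form[OF gaussian_vector_measurable[OF Z]]) auto
  let ?f = "\<lambda>\<omega> g. iexp (\<Sum>i=1..n. r * g i * Z i \<omega>)"
  have iexp_sum: "iexp (\<Sum>i=1..n. f i) = (\<Prod>i=1..n. iexp (f i))" for f :: "nat \<Rightarrow> real"
    by (simp add: exp_sum sum_distrib_left)
  have "complex_of_real (\<integral>\<omega>. exp (- (s * (\<Sum>i=1..n. (Z i \<omega>)\<^sup>2))) \<partial>M) =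
    (\<integral>\<omega>. complex_of_real (exp (- (s * (\<Sum>i=1..n. (Z i \<omega>)\<^sup>2)))) \<partial>M)"
    by (rule integral_complex_of_real[symmetric])
  also have "\<dots> = (\<integral>\<omega>. (\<integral>g. ?f \<omega> g \<partial>?G) \<partial>M)"
  proof (rule Bochner_Integration.integral_cong[OF refl])
    fix \<omega>
    have "complex_of_real (exp (- (s * (\<Sum>i=1..n. (Z i \<omega>)\<^sup>2)))) =
      (\<Prod>i=1..n. complex_of_real (exp (- ((r * Z i \<omega>)\<^sup>2) / 2)))"
      by (simp add: exp_sum sum_distrib_left power_mult_distrib r2 sum_negf[symmetric] 
            of_real_prod[symmetric] del: of_real_exp of_real_prod)
    also have "\<dots> = (\<Prod>i=1..n. char std_normal_distribution (r * Z i \<omega>))"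
      by (simp only: char_std_normal_distribution)
    also have "\<dots> = (\<Prod>i=1..n. \<integral>x. iexp (r * Z i \<omega> * x) \<partial>std_normal_distribution)"
      by (simp only: char_def)
    also have "\<dots> = (\<integral>g. (\<Prod>i=1..n. iexp (r * Z i \<omega> * g i)) \<partial>?G)"
      by (rule P.product_integral_prod[symmetric])
         (auto intro!: g.integrable_const_bound[of _ 1])
    also have "\<dots> = (\<integral>g. ?f \<omega> g \<partial>?G)"
      unfolding iexp_sum by (simp only: mult_ac)
    finally show "complex_of_real (exp (- (s * (\<Sum>i=1..n. (Z i \<omega>)\<^sup>2)))) = (\<integral>g. ?f \<omega> g \<partial>?G)" .
  qed
  also have "\<dots> = (\<integral>g. (\<integral>\<omega>. ?f \<omega> g \<partial>M) \<partial>?G)"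
  proof (rule MG.Fubini_integral[symmetric], rule MG.P.integrable_const_bound[of _ 1])
    have "(\<lambda>x. iexp x) \<in> borel_measurable borel" by measurable
    from measurable_compose[OF meas this]
    show "(\<lambda>(\<omega>, g). ?f \<omega> g) \<in> borel_measurable (M \<Otimes>\<^sub>M ?G)" by (simp add: split_beta')
  qed auto
  also have "\<dots> = (\<integral>g. (\<Prod>i=1..n. complex_of_real (exp (- (s * l i * (g i)\<^sup>2)))) \<partial>?G)"
  proof (rule Bochner_Integration.integral_cong[OF refl])
    fix g :: "nat \<Rightarrow> real"
    have "(\<integral>\<omega>. ?f \<omega> g \<partial>M) = complex_of_real (exp (- (\<Sum>i=1..n. l i * (r * g i)\<^sup>2) / 2))"
      using centered_gaussian_moments(3)[OF M Z[unfolded gaussian_vector_def, THEN spec] mean,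
          of "\<lambda>i. r * g i"]
      by (simp only: var)
    also have "- (\<Sum>i=1..n. l i * (r * g i)\<^sup>2) / 2 = (\<Sum>i=1..n. - (s * l i * (g i)\<^sup>2))"
      by (simp add: sum_divide_distrib power_mult_distrib r2 mult_ac sum_negf)
    finally show "(\<integral>\<omega>. ?f \<omega> g \<partial>M) = (\<Prod>i=1..n. complex_of_real (exp (- (s * l i * (g i)\<^sup>2))))"
      by (simp add: exp_sum del: of_real_exp)
  qed
  also have "\<dots> = (\<Prod>i=1..n. \<integral>x. complex_of_real (exp (- (s * l i * x\<^sup>2))) \<partial>std_normal_distribution)"
    using l s
    by (intro P.product_integral_prod integrable_of_real integral_std_normal_exp_neg_square) auto
  also have "\<dots> = (\<Prod>i=1..n. complex_of_real (1 / sqrt (1 + 2 * (s * l i))))"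
    using l s
    by (intro prod.cong refl, subst integral_complex_of_real)
       (simp add: integral_std_normal_exp_neg_square)
  finally show ?thesis by (simp only: of_real_prod[symmetric] of_real_eq_iff)
qed

section \<open>Sub-gamma tail bounds\<close>

text \<open>
  The derivative of right side minus left side is \<open>x\<^sup>2 / (2 * (1 - x)\<^sup>2)\<close>.
\<close>
lemma neg_ln_one_minus_le:
  assumes x: "0 \<le> x" "x < (1::real)"
  shows "- ln (1 - x) \<le> x + x\<^sup>2 / (2 * (1 - x))"
proof -
  let ?f = "\<lambda>y::real. y + y\<^sup>2 / (2 * (1 - y)) + ln (1 - y)"
  have "?f 0 \<le> ?f x"
  proof (rule DERIV_nonneg_imp_nondecreasing[OF x(1)])
    fix y assume y: "0 \<le> y" "y \<le> x"
    then have y1: "y < 1" using x by simp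
    have d: "(?f has_real_derivative
        1 + (2 * y * (2 * (1 - y)) - y\<^sup>2 * (- 2)) / ((2 * (1 - y)) * (2 * (1 - y))) - 1 / (1 - y)) (at y)"
      using y1 by (auto intro!: derivative_eq_intros)
    define z where "z = 1 - y"
    have "1 + (2 * y * (2 * z) - y\<^sup>2 * (- 2)) / ((2 * z) * (2 * z)) - 1 / z = y\<^sup>2 / (2 * z\<^sup>2)"
    proof -
      have z: "z > 0" "y = 1 - z" using y1 by (auto simp: z_def)
      show ?thesis using z(1) unfolding z(2) by (simp add: field_simps power2_eq_square)
    qed
    then show "\<exists>d. (?f has_real_derivative d) (at y) \<and> 0 \<le> d"
      using d unfolding z_def by (intro exI[of _ "y\<^sup>2 / (2 * (1 - y)\<^sup>2)"]) simp
  qed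
  then show ?thesis by simp
qed

text \<open>
  The derivative of right side minus left side is \<open>x\<^sup>2 / (1 + x)\<close>.
\<close>
lemma ln_one_plus_ge:
  assumes x: "0 \<le> (x::real)"
  shows "x - x\<^sup>2 / 2 \<le> ln (1 + x)"
proof -
  let ?f = "\<lambda>y::real. ln (1 + y) - y + y\<^sup>2 / 2"
  have "?f 0 \<le> ?f x"
  proof (rule DERIV_nonneg_imp_nondecreasing[OF x(1)])
    fix y assume y: "0 \<le> y" "y \<le> x"
    have d: "(?f has_real_derivative 1 / (1 + y) - 1 + y) (at y)"
      using y by (auto intro!: derivative_eq_intros)
    have "1 / (1 + y) - 1 + y = y\<^sup>2 / (1 + y)" using y by (simp add: field_simps power2_eq_square)
    with d y show "\<exists>d. (?f has_real_derivative d) (at y) \<and> 0 \<le> d"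
      by (intro exI[of _ "y\<^sup>2 / (1 + y)"]) simp
  qed
  then show ?thesis by simp
qed

text \<open>
  For standard normal \<open>g\<close>, the left side is the moment generating function of \<open>g\<^sup>2 - 1\<close> at \<open>x\<close>, and in
  the next lemma that of \<open>1 - g\<^sup>2\<close>.
\<close>
lemma centered_square_mgf_upper:
  assumes x: "0 \<le> x" "2 * x < (1::real)"
  shows "exp (- x) * (1 / sqrt (1 - 2 * x)) \<le> exp (x\<^sup>2 / (1 - 2 * x))"
proof -
  have sqrt: "1 / sqrt (1 - 2 * x) = exp (- ln (1 - 2 * x) / 2)"
    using x by (simp add: exp_minus ln_sqrt[symmetric] inverse_eq_divide)
  have "- ln (1 - 2 * x) \<le> 2 * x + (2 * x)\<^sup>2 / (2 * (1 - 2 * x))"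
    using x by (intro neg_ln_one_minus_le) auto
  moreover have "(2 * x)\<^sup>2 / (2 * (1 - 2 * x)) = 2 * (x\<^sup>2 / (1 - 2 * x))"
    using x by (simp add: divide_simps power_mult_distrib)
  ultimately have "- x + - ln (1 - 2 * x) / 2 \<le> x\<^sup>2 / (1 - 2 * x)" by linarith
  then show ?thesis unfolding sqrt by (simp add: exp_add[symmetric])
qed

lemma centered_square_mgf_lower:
  assumes x: "0 \<le> (x::real)"
  shows "exp x * (1 / sqrt (1 + 2 * x)) \<le> exp (x\<^sup>2)"
proof -
  have "1 / sqrt (1 + 2 * x) = exp (- ln (1 + 2 * x) / 2)"
    using x by (simp add: exp_minus ln_sqrt[symmetric] inverse_eq_divide)
  moreover have "2 * x - (2 * x)\<^sup>2 / 2 \<le> ln (1 + 2 * x)"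
    using x by (intro ln_one_plus_ge) auto
  then have "x + - ln (1 + 2 * x) / 2 \<le> x\<^sup>2" by (simp add: power_mult_distrib)
  ultimately show ?thesis by (simp add: exp_add[symmetric])
qed

text \<open>
  Chernoff's bound, \<open>exp (- s * t + s\<^sup>2 * v / (2 * (1 - c * s)))\<close>, at the \<open>s\<close> that minimizes the exponent.
  With \<open>u = c * t / v\<close> and \<open>r = sqrt (1 + 2 * u)\<close> the minimizer satisfies \<open>1 - c * s = 1 / r\<close>, and the
  minimum is \<open>- (v / c\<^sup>2) * (r - 1)\<^sup>2 / 2\<close>, where \<open>(r - 1)\<^sup>2 / 2 = H_fun u\<close>.
\<close>
lemma sub_gamma_tail:
  assumes M: "prob_space M" and S [measurable]: "S \<in> borel_measurable M"
    and pos: "0 < v" "0 < c" "0 < t"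
    and mgf: "\<And>s. 0 \<le> s \<Longrightarrow> c * s < 1 \<Longrightarrow>
      (\<integral>\<^sup>+\<omega>. ennreal (exp (s * S \<omega>)) \<partial>M) \<le> ennreal (exp (s\<^sup>2 * v / (2 * (1 - c * s))))"
  shows "measure M {\<omega> \<in> space M. S \<omega> > t} \<le> exp (- (v / c\<^sup>2) * H_fun (c * t / v))"
proof -
  interpret prob_space M by fact
  define u where "u = c * t / v"
  define r where "r = sqrt (1 + 2 * u)"
  have u: "u > 0" using pos by (simp add: u_def)
  have r1: "r > 1" using u by (simp add: r_def)
  have r2: "r\<^sup>2 = 1 + 2 * u" using u by (simp add: r_def)
  define s where "s = (1 - 1 / r) / c"
  have s: "s > 0" using r1 pos by (simp add: s_def)
  have cs: "1 - c * s = 1 / r" using pos by (simp add: s_def)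
  have t: "t = v / c * ((r\<^sup>2 - 1) / 2)" using pos by (simp add: r2 u_def)
  have exponent: "- s * t + s\<^sup>2 * v / (2 * (1 - c * s)) = - (v / c\<^sup>2) * H_fun u"
  proof -
    have "- s * t = - (v / c\<^sup>2) * ((1 - 1 / r) * ((r\<^sup>2 - 1) / 2))"
      unfolding t s_def by (simp add: power2_eq_square mult_ac)
    moreover have "s\<^sup>2 * v / (2 * (1 - c * s)) = (v / c\<^sup>2) * ((1 - 1 / r)\<^sup>2 * r / 2)"
      unfolding cs unfolding s_def by (simp add: power_divide)
    moreover have "- k * x + k * y = - k * (x - y)" for k x y :: real by (simp add: algebra_simps)
    moreover have "(1 - 1 / r) * ((r\<^sup>2 - 1) / 2) - (1 - 1 / r)\<^sup>2 * r / 2 = (r - 1)\<^sup>2 / 2"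
      using r1 by (simp add: field_simps power2_eq_square)
    moreover have "H_fun u = (r - 1)\<^sup>2 / 2"
      unfolding H_fun_def r_def[symmetric] using r2 by (simp add: power2_eq_square field_simps)
    ultimately show ?thesis by (simp only:)
  qed
  have "emeasure M {\<omega> \<in> space M. S \<omega> > t} \<le> emeasure M {\<omega> \<in> space M. S \<omega> \<ge> t}"
    by (intro emeasure_mono) auto
  also have "\<dots> \<le> ennreal (exp (- s * t)) *
      (\<integral>\<^sup>+\<omega>. ennreal (exp (s * S \<omega>)) * indicator (space M) \<omega> \<partial>M)"
    by (rule Chernoff_ineq_nn_integral_ge[OF s]) auto
  also have "(\<integral>\<^sup>+\<omega>. ennreal (exp (s * S \<omega>)) * indicator (space M) \<omega> \<partial>M) =
      (\<integral>\<^sup>+\<omega>. ennreal (exp (s * S \<omega>)) \<partial>M)"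
    by (rule nn_integral_cong) simp
  also have "\<dots> \<le> ennreal (exp (s\<^sup>2 * v / (2 * (1 - c * s))))"
  proof (rule mgf)
    have "1 - c * s > 0" unfolding cs using r1 by simp
    then show "c * s < 1" by simp
  qed (use s in simp)
  finally have "emeasure M {\<omega> \<in> space M. S \<omega> > t} \<le>
      ennreal (exp (- s * t)) * ennreal (exp (s\<^sup>2 * v / (2 * (1 - c * s))))"
    by (simp add: mult_left_mono)
  also have "\<dots> = ennreal (exp (- (v / c\<^sup>2) * H_fun u))"
    unfolding exponent[symmetric] by (simp add: ennreal_mult'[symmetric] exp_add[symmetric])
  finally show ?thesis unfolding u_def[symmetric] by (simp add: emeasure_eq_measure)
qed

section \<open>Linear images and principal components of Gaussian vectors\<close>

lemma gaussian_vector_linear_image: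
  assumes X: "gaussian_vector M n X"
    and Y: "\<And>j. j \<in> {1..m} \<Longrightarrow> Y j = (\<lambda>\<omega>. \<Sum>k=1..n. c j k * X k \<omega>)"
  shows "gaussian_vector M m Y"
  unfolding gaussian_vector_def
proof
  fix a :: "nat \<Rightarrow> real"
  have "(\<Sum>j=1..m. a j * Y j \<omega>) = (\<Sum>k=1..n. (\<Sum>j=1..m. a j * c j k) * X k \<omega>)" for \<omega>
  proof -
    have "(\<Sum>j=1..m. a j * Y j \<omega>) = (\<Sum>j=1..m. \<Sum>k=1..n. a j * c j k * X k \<omega>)"
      by (rule sum.cong) (simp_all add: Y sum_distrib_left mult.assoc)
    also have "\<dots> = (\<Sum>k=1..n. \<Sum>j=1..m. a j * c j k * X k \<omega>)" by (rule sum.swap)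
    finally show ?thesis by (simp add: sum_distrib_right)
  qed
  then show "gaussian_rv M (\<lambda>\<omega>. \<Sum>j=1..m. a j * Y j \<omega>)"
    using X unfolding gaussian_vector_def by simp
qed

context
  fixes M :: "'a measure" and n :: nat and X :: "nat \<Rightarrow> 'a \<Rightarrow> real"
  assumes M: "prob_space M" and X: "gaussian_vector M n X" and X0: "centered_vector M n X"
begin

lemma centered_gaussian_vector_integrable_prod:
  assumes "j \<in> {1..n}" "k \<in> {1..n}"
  shows "integrable M (\<lambda>\<omega>. X j \<omega> * X k \<omega>)"
proof -
  have sq: "integrable M (\<lambda>\<omega>. (X i \<omega>)\<^sup>2)" if "i \<in> {1..n}" for i
    using centered_gaussian_moments(1)[OF M gaussian_vector_component[OF X that]] X0 that
    by (simp add: centered_vector_def)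
  show ?thesis
  proof (rule Bochner_Integration.integrable_bound)
    show "integrable M (\<lambda>\<omega>. (X j \<omega>)\<^sup>2 + (X k \<omega>)\<^sup>2)" using assms sq by simp
    show "(\<lambda>\<omega>. X j \<omega> * X k \<omega>) \<in> borel_measurable M"
      using assms gaussian_vector_measurable[OF X] by simp
    have "\<bar>x * y\<bar> \<le> x\<^sup>2 + y\<^sup>2" for x y :: real
    proof -
      have "0 \<le> (\<bar>x\<bar> - \<bar>y\<bar>)\<^sup>2" by simp
      then have "2 * \<bar>x * y\<bar> \<le> x\<^sup>2 + y\<^sup>2" by (simp add: power2_diff abs_mult)
      then show ?thesis by simp
    qed
    then show "AE \<omega> in M. norm (X j \<omega> * X k \<omega>) \<le> norm ((X j \<omega>)\<^sup>2 + (X k \<omega>)\<^sup>2)" by simp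
  qed
qed

lemma centered_gaussian_vector_integrable:
  assumes "j \<in> {1..n}" shows "integrable M (X j)"
proof -
  interpret prob_space M by (rule M)
  show ?thesis
    using gaussian_vector_measurable[OF X assms]
      centered_gaussian_vector_integrable_prod[OF assms assms, folded power2_eq_square]
    by (rule square_integrable_imp_integrable)
qed

lemma centered_gaussian_vector_linear_mean:
  "(\<integral>\<omega>. (\<Sum>j=1..n. a j * X j \<omega>) \<partial>M) = 0"
proof -
  have "(\<integral>\<omega>. (\<Sum>j=1..n. a j * X j \<omega>) \<partial>M) = (\<Sum>j=1..n. a j * (\<integral>\<omega>. X j \<omega> \<partial>M))"
    using centered_gaussian_vector_integrable by (subst Bochner_Integration.integral_sum) auto
  also have "\<dots> = 0" using X0 by (intro sum.neutral) (simp add: centered_vector_def)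
  finally show ?thesis .
qed

text \<open>
  Bilinearity of the covariance; the covariance matrix thus determines the variance of every linear
  form.
\<close>
lemma centered_gaussian_vector_linear_cov:
  "(\<integral>\<omega>. (\<Sum>j=1..n. a j * X j \<omega>) * (\<Sum>k=1..n. b k * X k \<omega>) \<partial>M) =
    (\<Sum>j=1..n. \<Sum>k=1..n. a j * b k * (\<integral>\<omega>. X j \<omega> * X k \<omega> \<partial>M))"
proof -
  have "(\<integral>\<omega>. (\<Sum>j=1..n. a j * X j \<omega>) * (\<Sum>k=1..n. b k * X k \<omega>) \<partial>M) =
    (\<integral>\<omega>. (\<Sum>j=1..n. \<Sum>k=1..n. a j * b k * (X j \<omega> * X k \<omega>)) \<partial>M)"
    by (simp add: sum_product mult_ac)
  also have "\<dots> = (\<Sum>j=1..n. \<integral>\<omega>. (\<Sum>k=1..n. a j * b k * (X j \<omega> * X k \<omega>)) \<partial>M)"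
    using centered_gaussian_vector_integrable_prod
    by (intro Bochner_Integration.integral_sum Bochner_Integration.integrable_sum integrable_mult_right) auto
  also have "\<dots> = (\<Sum>j=1..n. \<Sum>k=1..n. \<integral>\<omega>. a j * b k * (X j \<omega> * X k \<omega>) \<partial>M)"
    using centered_gaussian_vector_integrable_prod
    by (intro sum.cong refl Bochner_Integration.integral_sum integrable_mult_right) auto
  finally show ?thesis by simp
qed

lemma centered_gaussian_vector_covariance:
  "j \<in> {1..n} \<Longrightarrow> k \<in> {1..n} \<Longrightarrow> covariance M (X j) (X k) = (\<integral>\<omega>. X j \<omega> * X k \<omega> \<partial>M)"
  using X0 by (simp add: covariance_def centered_vector_def)

text \<open>
  Rotating \<open>X\<close> to the eigenbasis of its covariance matrix gives uncorrelated components with variances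
  \<open>l i\<close>. Since the rotation is orthogonal, the sum of squares does not change at any point \<open>\<omega>\<close>.
\<close>
theorem gaussian_vector_principal_components:
  assumes l: "eigenvalues_with_mult (covariance_matrix M n X) n l"
  shows "\<exists>Z. gaussian_vector M n Z \<and> centered_vector M n Z \<and>
    (\<forall>i\<in>{1..n}. \<forall>j\<in>{1..n}. (\<integral>\<omega>. Z i \<omega> * Z j \<omega> \<partial>M) = (if i = j then l i else 0)) \<and>
    (\<forall>\<omega>. (\<Sum>i=1..n. (Z i \<omega>)\<^sup>2) = (\<Sum>i=1..n. (X i \<omega>)\<^sup>2))"
proof -
  let ?C = "covariance_matrix M n X"
  have C: "?C $$ (a - 1, b - 1) = (\<integral>\<omega>. X a \<omega> * X b \<omega> \<partial>M)" if "a \<in> {1..n}" "b \<in> {1..n}" for a b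
  proof -
    have "a - 1 < n" "b - 1 < n" "Suc (a - 1) = a" "Suc (b - 1) = b" using that by auto
    then have "?C $$ (a - 1, b - 1) = covariance M (X a) (X b)"
      by (simp add: covariance_matrix_def)
    then show ?thesis using centered_gaussian_vector_covariance[OF that] by simp
  qed
  have "?C \<in> carrier_mat n n" by (simp add: covariance_matrix_def)
  moreover have "transpose_mat ?C = ?C"
    by (intro eq_matI) (auto simp: covariance_matrix_def covariance_def mult.commute)
  ultimately obtain u :: "nat \<Rightarrow> nat \<Rightarrow> real" where
    u1: "\<forall>a\<in>{1..n}. \<forall>b\<in>{1..n}. (\<Sum>i=1..n. u i a * u i b) = (if a = b then 1 else 0)"
    and u2: "\<forall>i\<in>{1..n}. \<forall>j\<in>{1..n}.
      (\<Sum>a=1..n. \<Sum>b=1..n. u i a * u j b * ?C $$ (a - 1, b - 1)) = (if i = j then l i else 0)"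
    using symmetric_diagonalization_coefficients l by blast
  define Z where "Z i \<omega> = (\<Sum>a=1..n. u i a * X a \<omega>)" for i \<omega>
  show ?thesis
  proof (intro exI[of _ Z] conjI ballI allI)
    show "gaussian_vector M n Z"
      by (rule gaussian_vector_linear_image[OF X, of _ _ u]) (simp add: Z_def fun_eq_iff)
    show "centered_vector M n Z"
      unfolding centered_vector_def Z_def[abs_def] using centered_gaussian_vector_linear_mean by simp
    fix i j assume ij: "i \<in> {1..n}" "j \<in> {1..n}"
    have "(\<integral>\<omega>. Z i \<omega> * Z j \<omega> \<partial>M) = (\<Sum>a=1..n. \<Sum>b=1..n. u i a * u j b * (\<integral>\<omega>. X a \<omega> * X b \<omega> \<partial>M))"
      unfolding Z_def by (rule centered_gaussian_vector_linear_cov)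
    also have "\<dots> = (\<Sum>a=1..n. \<Sum>b=1..n. u i a * u j b * ?C $$ (a - 1, b - 1))"
      by (intro sum.cong refl) (simp only: C)
    finally show "(\<integral>\<omega>. Z i \<omega> * Z j \<omega> \<partial>M) = (if i = j then l i else 0)"
      using u2 ij by simp
  next
    fix \<omega>
    have "(\<Sum>i=1..n. (Z i \<omega>)\<^sup>2) = (\<Sum>i=1..n. \<Sum>a=1..n. \<Sum>b=1..n. u i a * u i b * (X a \<omega> * X b \<omega>))"
      unfolding Z_def power2_eq_square by (simp add: sum_product mult_ac)
    also have "\<dots> = (\<Sum>a=1..n. \<Sum>i=1..n. \<Sum>b=1..n. u i a * u i b * (X a \<omega> * X b \<omega>))"
      by (rule sum.swap)
    also have "\<dots> = (\<Sum>a=1..n. \<Sum>b=1..n. \<Sum>i=1..n. u i a * u i b * (X a \<omega> * X b \<omega>))"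
      by (intro sum.cong refl sum.swap)
    also have "\<dots> = (\<Sum>a=1..n. \<Sum>b=1..n. if b = a then X a \<omega> * X b \<omega> else 0)"
      using u1 by (intro sum.cong refl) (simp add: sum_distrib_right[symmetric])
    also have "\<dots> = (\<Sum>a=1..n. (X a \<omega>)\<^sup>2)"
      by (intro sum.cong refl) (simp add: power2_eq_square)
    finally show "(\<Sum>i=1..n. (Z i \<omega>)\<^sup>2) = (\<Sum>i=1..n. (X i \<omega>)\<^sup>2)" .
  qed
qed

end

section \<open>Concentration of the time averaged mean square displacement\<close>

text \<open>
  Both \<open>S\<close> and \<open>- S\<close> have a moment generating function bounded by \<open>exp (s\<^sup>2 * v / (2 * (1 - c * s)))\<close>, as
  \<open>sub_gamma_tail\<close> requires. It is a product over \<open>i\<close>, each factor of which is bounded by a scalar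
  inequality at \<open>x = s * l i\<close>; replacing the denominators there (\<open>1 - 2 * s * l i\<close> for \<open>S\<close> and
  \<open>1\<close> for \<open>- S\<close>) by their common lower bound \<open>1 - c * s\<close> allows the exponents to be summed.
\<close>
lemma decorrelated_gaussian_square_sum_concentration:
  assumes M: "prob_space M" and Z: "gaussian_vector M n Z" and Z0: "centered_vector M n Z"
    and cov: "\<And>i j. i \<in> {1..n} \<Longrightarrow> j \<in> {1..n} \<Longrightarrow>
      (\<integral>\<omega>. Z i \<omega> * Z j \<omega> \<partial>M) = (if i = j then l i else 0)"
    and c: "c > 0" "\<And>i. i \<in> {1..n} \<Longrightarrow> 2 * l i \<le> c"
    and v: "(\<Sum>i=1..n. (l i)\<^sup>2) > 0" and t: "t > 0"
  defines "S \<equiv> \<lambda>\<omega>. (\<Sum>i=1..n. (Z i \<omega>)\<^sup>2) - (\<Sum>i=1..n. l i)"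
  defines "v \<equiv> 2 * (\<Sum>i=1..n. (l i)\<^sup>2)"
  shows "measure M {\<omega> \<in> space M. \<bar>S \<omega>\<bar> > t} \<le> 2 * exp (- (v / c\<^sup>2) * H_fun (c * t / v))"
proof -
  interpret prob_space M by fact
  have meas [measurable]: "S \<in> borel_measurable M"
    unfolding S_def
    by (intro borel_measurable_diff borel_measurable_sum borel_measurable_power
        gaussian_vector_measurable[OF Z] borel_measurable_const)
  have l: "0 \<le> l i" if "i \<in> {1..n}" for i
  proof -
    have "0 \<le> (\<integral>\<omega>. Z i \<omega> * Z i \<omega> \<partial>M)" by simp
    then show ?thesis using cov[OF that that] by simp
  qed
  note mean = centered_gaussian_vector_linear_mean[OF M Z Z0]
  have var: "(\<integral>\<omega>. (\<Sum>i=1..n. a i * Z i \<omega>)\<^sup>2 \<partial>M) = (\<Sum>i=1..n. l i * (a i)\<^sup>2)" for a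
  proof -
    have "(\<integral>\<omega>. (\<Sum>i=1..n. a i * Z i \<omega>)\<^sup>2 \<partial>M) =
      (\<Sum>i=1..n. \<Sum>j=1..n. a i * a j * (\<integral>\<omega>. Z i \<omega> * Z j \<omega> \<partial>M))"
      unfolding power2_eq_square by (rule centered_gaussian_vector_linear_cov[OF M Z Z0])
    also have "\<dots> = (\<Sum>i=1..n. \<Sum>j=1..n. if j = i then l i * (a i)\<^sup>2 else 0)"
      by (intro sum.cong refl) (simp add: cov power2_eq_square)
    also have "\<dots> = (\<Sum>i=1..n. l i * (a i)\<^sup>2)" by (intro sum.cong refl) simp
    finally show ?thesis .
  qed
  have collect: "(\<Prod>i=1..n. exp ((s * l i)\<^sup>2 / (1 - c * s))) = exp (s\<^sup>2 * v / (2 * (1 - c * s)))"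
    if "c * s < 1" for s
  proof -
    have "(\<Sum>i=1..n. (s * l i)\<^sup>2 / (1 - c * s)) = s\<^sup>2 * (\<Sum>i=1..n. (l i)\<^sup>2) / (1 - c * s)"
      by (simp add: power_mult_distrib sum_distrib_left sum_divide_distrib)
    also have "\<dots> = s\<^sup>2 * v / (2 * (1 - c * s))" using that by (simp add: v_def field_simps)
    finally show ?thesis by (subst exp_sum[symmetric]) simp_all
  qed
  have upper: "(\<integral>\<^sup>+\<omega>. ennreal (exp (s * S \<omega>)) \<partial>M) \<le> ennreal (exp (s\<^sup>2 * v / (2 * (1 - c * s))))"
    if s: "0 \<le> s" "c * s < 1" for s
  proof -
    have sl: "2 * (s * l i) \<le> c * s" if "i \<in> {1..n}" for i
      using mult_right_mono[OF c(2)[OF that] s(1)] by (simp add: mult_ac)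
    then have sl1: "2 * (s * l i) < 1" if "i \<in> {1..n}" for i
      using s(2) that by (meson le_less_trans)
    have "(\<integral>\<^sup>+\<omega>. ennreal (exp (s * S \<omega>)) \<partial>M) =
      (\<integral>\<^sup>+\<omega>. ennreal (\<Prod>i=1..n. exp (- (s * l i))) * ennreal (exp (s * (\<Sum>i=1..n. (Z i \<omega>)\<^sup>2))) \<partial>M)"
      unfolding S_def
      by (intro nn_integral_cong)
         (simp add: ennreal_mult'[symmetric] prod_nonneg exp_sum[symmetric] sum_negf
           sum_distrib_left[symmetric] exp_add[symmetric] right_diff_distrib)
    also have "\<dots> = ennreal (\<Prod>i=1..n. exp (- (s * l i))) *
        ennreal (\<Prod>i=1..n. 1 / sqrt (1 - 2 * (s * l i)))"
      using gaussian_vector_measurable[OF Z]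
      by (subst nn_integral_cmult, simp)
         (simp only: nn_integral_exp_gaussian_square_sum[OF M Z mean var s(1) sl1])
    also have "\<dots> = ennreal (\<Prod>i=1..n. exp (- (s * l i)) * (1 / sqrt (1 - 2 * (s * l i))))"
      by (simp add: ennreal_mult'[symmetric] prod_nonneg prod.distrib[symmetric])
    also have "\<dots> \<le> ennreal (\<Prod>i=1..n. exp ((s * l i)\<^sup>2 / (1 - 2 * (s * l i))))"
      using sl1 l s
      by (intro ennreal_leI prod_mono conjI centered_square_mgf_upper) (auto simp: less_imp_le)
    also have "\<dots> \<le> ennreal (\<Prod>i=1..n. exp ((s * l i)\<^sup>2 / (1 - c * s)))"
    proof (intro ennreal_leI prod_mono conjI)
      fix i assume i: "i \<in> {1..n}"
      have "(s * l i)\<^sup>2 / (1 - 2 * (s * l i)) \<le> (s * l i)\<^sup>2 / (1 - c * s)"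
        using sl[OF i] s(2) by (intro divide_left_mono) auto
      then show "exp ((s * l i)\<^sup>2 / (1 - 2 * (s * l i))) \<le> exp ((s * l i)\<^sup>2 / (1 - c * s))" by simp
    qed simp
    also have "(\<Prod>i=1..n. exp ((s * l i)\<^sup>2 / (1 - c * s))) = exp (s\<^sup>2 * v / (2 * (1 - c * s)))"
      using s(2) by (rule collect)
    finally show ?thesis .
  qed
  have lower: "(\<integral>\<^sup>+\<omega>. ennreal (exp (s * - S \<omega>)) \<partial>M) \<le> ennreal (exp (s\<^sup>2 * v / (2 * (1 - c * s))))"
    if s: "0 \<le> s" "c * s < 1" for s
  proof -
    have int: "integrable M (\<lambda>\<omega>. exp (- (s * (\<Sum>i=1..n. (Z i \<omega>)\<^sup>2))))"
      using s gaussian_vector_measurable[OF Z]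
      by (intro integrable_const_bound[of _ 1]) (auto intro!: mult_nonneg_nonneg sum_nonneg)
    have "(\<integral>\<^sup>+\<omega>. ennreal (exp (s * - S \<omega>)) \<partial>M) =
      (\<integral>\<^sup>+\<omega>. ennreal (\<Prod>i=1..n. exp (s * l i)) * ennreal (exp (- (s * (\<Sum>i=1..n. (Z i \<omega>)\<^sup>2)))) \<partial>M)"
      unfolding S_def
      by (intro nn_integral_cong)
         (simp add: ennreal_mult'[symmetric] prod_nonneg exp_sum[symmetric]
           sum_distrib_left[symmetric] exp_add[symmetric] right_diff_distrib)
    also have "\<dots> = ennreal (\<Prod>i=1..n. exp (s * l i)) *
        ennreal (\<Prod>i=1..n. 1 / sqrt (1 + 2 * (s * l i)))"
      using gaussian_vector_measurable[OF Z]
      by (subst nn_integral_cmult, simp, subst nn_integral_eq_integral[OF int], simp)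
         (simp only: integral_exp_neg_gaussian_square_sum[OF M Z mean var l s(1)])
    also have "\<dots> = ennreal (\<Prod>i=1..n. exp (s * l i) * (1 / sqrt (1 + 2 * (s * l i))))"
      by (simp add: ennreal_mult'[symmetric] prod_nonneg prod.distrib[symmetric])
    also have "\<dots> \<le> ennreal (\<Prod>i=1..n. exp ((s * l i)\<^sup>2 / (1 - c * s)))"
    proof (intro ennreal_leI prod_mono conjI)
      fix i assume i: "i \<in> {1..n}"
      have "c * s \<ge> 0" using c s by simp
      then have "(s * l i)\<^sup>2 / 1 \<le> (s * l i)\<^sup>2 / (1 - c * s)"
        using s(2) by (intro divide_left_mono) auto
      then have "exp ((s * l i)\<^sup>2) \<le> exp ((s * l i)\<^sup>2 / (1 - c * s))" by simp
      with centered_square_mgf_lower[of "s * l i"] l[OF i] s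
      show "exp (s * l i) * (1 / sqrt (1 + 2 * (s * l i))) \<le> exp ((s * l i)\<^sup>2 / (1 - c * s))"
        by (meson mult_nonneg_nonneg order_trans)
      show "0 \<le> exp (s * l i) * (1 / sqrt (1 + 2 * (s * l i)))" using l[OF i] s by simp
    qed
    also have "(\<Prod>i=1..n. exp ((s * l i)\<^sup>2 / (1 - c * s))) = exp (s\<^sup>2 * v / (2 * (1 - c * s)))"
      using s(2) by (rule collect)
    finally show ?thesis .
  qed
  have v0: "v > 0" using v by (simp add: v_def)
  let ?B = "exp (- (v / c\<^sup>2) * H_fun (c * t / v))"
  have "{\<omega> \<in> space M. \<bar>S \<omega>\<bar> > t} = {\<omega> \<in> space M. S \<omega> > t} \<union> {\<omega> \<in> space M. - S \<omega> > t}" by auto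
  then have "measure M {\<omega> \<in> space M. \<bar>S \<omega>\<bar> > t} \<le>
      measure M {\<omega> \<in> space M. S \<omega> > t} + measure M {\<omega> \<in> space M. - S \<omega> > t}"
    by (simp only:) (intro measure_Un_le, measurable)
  also have "\<dots> \<le> ?B + ?B"
    by (intro add_mono sub_gamma_tail[OF M _ v0 c(1) t] upper lower) measurable
  finally show ?thesis by simp
qed

lemma gaussian_vector_increment:
  assumes X: "gaussian_vector M N X"
  shows "gaussian_vector M (N - \<tau>) (increment \<tau> X)"
proof (rule gaussian_vector_linear_image[OF X])
  fix j assume j: "j \<in> {1..N - \<tau>}"
  define c where "c j k = (if k = j + \<tau> then 1 else 0) - (if k = j then 1 else (0::real))" for j k
  have "increment \<tau> X j \<omega> = (\<Sum>k=1..N. c j k * X k \<omega>)" for \<omega>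
  proof -
    have "(\<Sum>k=1..N. c j k * X k \<omega>) =
      (\<Sum>k=1..N. (if k = j + \<tau> then X k \<omega> else 0) - (if k = j then X k \<omega> else 0))"
      by (rule sum.cong) (auto simp: c_def)
    moreover have "j \<le> N" "j + \<tau> \<le> N" using j by auto
    ultimately show ?thesis using j by (simp add: sum_subtractf increment_def)
  qed
  then show "increment \<tau> X j = (\<lambda>\<omega>. \<Sum>k=1..N.
    ((if k = j + \<tau> then 1 else 0) - (if k = j then 1 else 0)) * X k \<omega>)"
    by (simp add: fun_eq_iff c_def)
qed

theorem theorem3p1:
  fixes M :: "'a measure" and X :: "nat \<Rightarrow> 'a \<Rightarrow> real"
    and N \<tau> :: nat and l :: "nat \<Rightarrow> real" and lbar \<epsilon> :: real
  assumes "prob_space M"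
    and "1 \<le> \<tau>" and "\<tau> < N"
    and "gaussian_vector M N X"
    and "centered_vector M N X"
    and "nondegenerate_vector M N X"
    and "eigenvalues_with_mult (increment_cov M N \<tau> X) (N - \<tau>) l"
    and "lbar = 2 * Max (l ` {1..N-\<tau>})"
    and "\<epsilon> > 0"
  shows "measure M {\<omega> \<in> space M. \<bar>tamsd N \<tau> X \<omega> - integral\<^sup>L M (tamsd N \<tau> X)\<bar> > \<epsilon>}
    \<le> 2 * exp (- (2 * (\<Sum>j=1..N-\<tau>. (l j)\<^sup>2) / lbar\<^sup>2)
             * H_fun (lbar * \<epsilon> * real (N - \<tau>) / (2 * (\<Sum>j=1..N-\<tau>. (l j)\<^sup>2))))"
proof -
  interpret prob_space M by fact
  note M = assms(1) and X = assms(4) and X0 = assms(5)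
  define n where "n = N - \<tau>"
  have n: "n > 0" using assms(3) by (simp add: n_def)
  let ?Y = "increment \<tau> X"
  have Y: "gaussian_vector M n ?Y"
    unfolding n_def using X by (rule gaussian_vector_increment)
  have Y0: "centered_vector M n ?Y"
    unfolding centered_vector_def
  proof
    fix j assume "j \<in> {1..n}"
    then have j: "j \<in> {1..N}" "j + \<tau> \<in> {1..N}" using assms(3) by (auto simp: n_def)
    have "integral\<^sup>L M (?Y j) = integral\<^sup>L M (X (j + \<tau>)) - integral\<^sup>L M (X j)"
      unfolding increment_def[abs_def]
      using centered_gaussian_vector_integrable[OF M X X0] j by (intro Bochner_Integration.integral_diff)
    then show "integral\<^sup>L M (?Y j) = 0" using X0 j by (simp add: centered_vector_def)
  qed
  have "eigenvalues_with_mult (covariance_matrix M n ?Y) n l"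
    using assms(7) by (simp add: increment_cov_def n_def)
  from gaussian_vector_principal_components[OF M Y Y0 this]
  obtain Z where Z: "gaussian_vector M n Z" and Z0: "centered_vector M n Z"
    and cov: "\<And>i j. i \<in> {1..n} \<Longrightarrow> j \<in> {1..n} \<Longrightarrow>
      (\<integral>\<omega>. Z i \<omega> * Z j \<omega> \<partial>M) = (if i = j then l i else 0)"
    and sq: "\<And>\<omega>. (\<Sum>i=1..n. (Z i \<omega>)\<^sup>2) = (\<Sum>i=1..n. (?Y i \<omega>)\<^sup>2)"
    by blast
  have tamsd: "tamsd N \<tau> X \<omega> = (\<Sum>i=1..n. (Z i \<omega>)\<^sup>2) / real n" for \<omega>
    unfolding tamsd_def sq increment_def n_def[symmetric] by simp
  have "(\<integral>\<omega>. (\<Sum>i=1..n. (Z i \<omega>)\<^sup>2) \<partial>M) = (\<Sum>i=1..n. \<integral>\<omega>. Z i \<omega> * Z i \<omega> \<partial>M)"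
    unfolding power2_eq_square using centered_gaussian_vector_integrable_prod[OF M Z Z0]
    by (intro Bochner_Integration.integral_sum)
  also have "\<dots> = (\<Sum>i=1..n. l i)" by (intro sum.cong refl) (simp add: cov)
  finally have mean: "integral\<^sup>L M (tamsd N \<tau> X) = (\<Sum>i=1..n. l i) / real n"
    unfolding tamsd[abs_def] by simp
  have event: "\<bar>tamsd N \<tau> X \<omega> - integral\<^sup>L M (tamsd N \<tau> X)\<bar> > \<epsilon> \<longleftrightarrow>
      \<bar>(\<Sum>i=1..n. (Z i \<omega>)\<^sup>2) - (\<Sum>i=1..n. l i)\<bar> > \<epsilon> * real n" for \<omega>
    unfolding tamsd mean diff_divide_distrib[symmetric] abs_divide using n by (simp add: field_simps)
  have lmax: "2 * l i \<le> lbar" if "i \<in> {1..n}" for i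
    using that unfolding assms(8) n_def[symmetric] by simp
  have l: "0 \<le> l i" if "i \<in> {1..n}" for i
  proof -
    have "0 \<le> (\<integral>\<omega>. Z i \<omega> * Z i \<omega> \<partial>M)" by simp
    then show ?thesis using cov[OF that that] by simp
  qed
  show ?thesis
  proof (cases "lbar > 0")
    case True
    have "Max (l ` {1..n}) \<in> l ` {1..n}" using n by (intro Max_in) auto
    then obtain k where k: "k \<in> {1..n}" "lbar = 2 * l k"
      unfolding assms(8) n_def[symmetric] by auto
    have "0 < (l k)\<^sup>2" using True k by simp
    also have "\<dots> \<le> (\<Sum>i=1..n. (l i)\<^sup>2)" using k by (intro member_le_sum) auto
    finally have "0 < (\<Sum>i=1..n. (l i)\<^sup>2)" .
    from decorrelated_gaussian_square_sum_concentration[OF M Z Z0 cov True lmax this, of "\<epsilon> * real n"]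
    show ?thesis using n assms(9) unfolding event n_def[symmetric] by (simp add: mult_ac)
  next
    case False
    \<comment> \<open>All \<open>l i\<close> vanish, and by the convention \<open>x / 0 = 0\<close> the right-hand side equals \<open>2\<close>.\<close>
    have "lbar = 0" using False l[of 1] lmax[of 1] n by auto
    then show ?thesis using prob_le_1 by (simp add: H_fun_def order_trans[OF prob_le_1])
  qed
qed

end
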